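(* Let $\mathbb{E}_1,\mathbb{E}_2$ be Euclidean spaces, let $K\subset\mathbb{E}_2$ be a closed, convex cone, let $F:\mathbb{E}_1\to\mathbb{E}_2^\bullet$ be proper and $K$-convex, and let $g\in\Gamma(\mathbb{E}_2)$ be such that $$g(F(x))\le g(y)\qquad\text{for all }(x,y)\in K\text{-}\mathrm{epi}\,F.$$ Define $\eta:\mathbb{E}_1\to\overline{\mathbb{R}}$ by $$\eta(p)=\inf_{v\in -K^\circ}\{g^*(v)+\langle v,F\rangle^*(p)\}.$$ Then the following hold. (a) $(g\circ F)^*\le \mathrm{cl}\,\eta$. Equality holds if, in addition, $\langle v,F\rangle\in\Gamma_0(\mathbb{E}_1)$ for all $v\in -K^\circ$, $g$ is lower semicontinuous and $K$-increasing, and $\mathrm{rge}\,F\cap\mathrm{dom}\,g\neq\emptyset$. (b) If $$F(\mathrm{ri}(\mathrm{dom}\,F))\cap\mathrm{ri}(\mathrm{dom}\,g-K)\neq\emptyset,$$ then $\eta$ is closed, proper and convex, and the infimum defining $\eta(p)$ is a minimum (possibly $+\infty$) for every $p$. (c) Under the condition in (b), $$(g\circ F)^*(p)=\min_{v\in -K^\circ}\{g^*(v)+\langle v,F\rangle^*(p)\}\qquad(p\in\mathbb{E}_1),$$ and $\mathrm{dom}\,(g\circ F)^*=\{p\in\mathbb{E}_1 : \exists\, v\in\mathrm{dom}\,g^*\cap(-K^\circ)\text{ with }\langle v,F\rangle^*(p)<+\infty\}$.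
   Context: A Euclidean space is a finite-dimensional real inner product space. $\overline{\mathbb{R}}=\mathbb{R}\cup\{\pm\infty\}$. A cone is a (nonempty) set $K$ with $\lambda x\in K$ for all $\lambda\ge0$, $x\in K$; its polar is $K^\circ=\{v : \langle v,x\rangle\le 0\ \forall x\in K\}$; and $u\le_K v$ means $v-u\in K$. $\mathbb{E}_2^\bullet=\mathbb{E}_2\cup\{+\infty_\bullet\}$, where $+\infty_\bullet$ is an adjoined largest element. For $F:\mathbb{E}_1\to\mathbb{E}_2^\bullet$: $\mathrm{dom}\,F=\{x : F(x)\in\mathbb{E}_2\}$, $\mathrm{rge}\,F=\{F(x) : x\in\mathrm{dom}\,F\}$, $F$ is proper if $\mathrm{dom}\,F\ne\emptyset$, $K\text{-}\mathrm{epi}\,F=\{(x,v)\in\mathbb{E}_1\times\mathbb{E}_2 : x\in\mathrm{dom}\,F,\ v-F(x)\in K\}$, and $F$ is $K$-convex if $K\text{-}\mathrm{epi}\,F$ is convex. $(g\circ F)(x)=g(F(x))$ if $x\in\mathrm{dom}\,F$ and $+\infty$ otherwise; $\langle v,F\rangle(x)=\langle v,F(x)\rangle$ if $x\in\mathrm{dom}\,F$ and $+\infty$ otherwise (also for $v=0$). $g$ is $K$-increasing if $g(u)\le g(v)$ whenever $u\le_K v$. $\Gamma(\mathbb{E})$ is the set of proper convex functions $\mathbb{E}\to\mathbb{R}\cup\{+\infty\}$ and $\Gamma_0(\mathbb{E})$ the lower semicontinuous ones among them. $f^*(y)=\sup_x\{\langle y,x\rangle-f(x)\}$ is the Fenchel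 conjugate, $\mathrm{cl}\,f$ is the lower semicontinuous hull, $\mathrm{ri}$ is the relative interior, and $\mathrm{dom}\,f=\{x : f(x)<+\infty\}$. *)

theory Defs
  imports "HOL-Analysis.Analysis"
begin


definition edom :: "('a \<Rightarrow> ereal) \<Rightarrow> 'a set" where
  "edom f = {x. f x < \<infinity>}"

definition epi :: "('a \<Rightarrow> ereal) \<Rightarrow> ('a \<times> real) set" where
  "epi f = {(x, r). f x \<le> ereal r}"

definition proper_fun :: "('a \<Rightarrow> ereal) \<Rightarrow> bool" where
  "proper_fun f \<longleftrightarrow> (\<forall>x. f x \<noteq> -\<infinity>) \<and> edom f \<noteq> {}"

definition convex_fun :: "('a::real_vector \<Rightarrow> ereal) \<Rightarrow> bool" where
  "convex_fun f \<longleftrightarrow> convex (epi f)"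

definition closed_fun :: "('a::topological_space \<Rightarrow> ereal) \<Rightarrow> bool" where
  "closed_fun f \<longleftrightarrow> closed (epi f)"

definition lsc_fun :: "('a::topological_space \<Rightarrow> ereal) \<Rightarrow> bool" where
  "lsc_fun f \<longleftrightarrow> (\<forall>x. f x \<le> Liminf (nhds x) f)"

text \<open>The lower semicontinuous hull is the largest lower semicontinuous minorant.  It is taken in
  the lattice of functions, also for improper functions: there is no convention that it collapses
  to the constant \<open>-\<infinity>\<close>.\<close>

definition lsc_hull :: "('a::topological_space \<Rightarrow> ereal) \<Rightarrow> 'a \<Rightarrow> ereal" where
  "lsc_hull f = Sup {h. lsc_fun h \<and> h \<le> f}"

definition Gamma_fun :: "('a::real_vector \<Rightarrow> ereal) set" where
  "Gamma_fun = {f. proper_fun f \<and> convex_fun f}"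

definition Gamma0_fun :: "('a::real_normed_vector \<Rightarrow> ereal) set" where
  "Gamma0_fun = {f \<in> Gamma_fun. lsc_fun f}"

definition fenchel_conjugate :: "('a::real_inner \<Rightarrow> ereal) \<Rightarrow> 'a \<Rightarrow> ereal" where
  "fenchel_conjugate f y = (SUP x. ereal (y \<bullet> x) - f x)"

definition polar :: "'a::real_inner set \<Rightarrow> 'a set" where
  "polar K = {v. \<forall>x\<in>K. v \<bullet> x \<le> 0}"

definition cone_le :: "'a::real_vector set \<Rightarrow> 'a \<Rightarrow> 'a \<Rightarrow> bool" where
  "cone_le K u v \<longleftrightarrow> v - u \<in> K"

definition cone_increasing :: "'a::real_vector set \<Rightarrow> ('a \<Rightarrow> ereal) \<Rightarrow> bool" where
  "cone_increasing K g \<longleftrightarrow> (\<forall>u v. cone_le K u v \<longrightarrow> g u \<le> g v)"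

text \<open>A function into a space with an adjoined largest element is a partial map:
  \<^const>\<open>None\<close> is the largest element, so that \<^const>\<open>Map.dom\<close> and
  \<^const>\<open>ran\<close> are the domain and the range in the sense of convex analysis.\<close>

definition cone_epi :: "'b::real_vector set \<Rightarrow> ('a \<rightharpoonup> 'b) \<Rightarrow> ('a \<times> 'b) set" where
  "cone_epi K F = {(x, v). x \<in> dom F \<and> v - the (F x) \<in> K}"

definition cone_convex :: "'b::real_vector set \<Rightarrow> ('a::real_vector \<rightharpoonup> 'b) \<Rightarrow> bool" where
  "cone_convex K F \<longleftrightarrow> convex (cone_epi K F)"

definition ext_compose :: "('b \<Rightarrow> ereal) \<Rightarrow> ('a \<rightharpoonup> 'b) \<Rightarrow> 'a \<Rightarrow> ereal" where
  "ext_compose g F x = (case F x of Some y \<Rightarrow> g y | None \<Rightarrow> \<infinity>)"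

definition scalarize :: "'b::real_inner \<Rightarrow> ('a \<rightharpoonup> 'b) \<Rightarrow> 'a \<Rightarrow> ereal" where
  "scalarize v F = ext_compose (\<lambda>y. ereal (v \<bullet> y)) F"

text \<open>Subtraction of sets in the library is set difference, hence a separate constant.\<close>

definition minkowski_diff :: "'a::real_vector set \<Rightarrow> 'a set \<Rightarrow> 'a set" where
  "minkowski_diff A B = {a - b | a b. a \<in> A \<and> b \<in> B}"

definition eta ::
    "'b::real_inner set \<Rightarrow> ('b \<Rightarrow> ereal) \<Rightarrow> ('a::real_inner \<rightharpoonup> 'b) \<Rightarrow> 'a \<Rightarrow> ereal" where
  "eta K g F p =
    (INF v \<in> uminus ` polar K. fenchel_conjugate g v + fenchel_conjugate (scalarize v F) p)"

end

theory Submission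
  imports Defs
begin

text \<open>Taking suprema over \<open>epi g\<close> and \<open>dom F\<close> separately bounds \<open>(g \<circ> F)\<^sup>*\<close> by every
  \<open>g\<^sup>* v + \<langle>v, F\<rangle>\<^sup>* p\<close>. Under the assumptions of (a), a lower semicontinuous minorant of \<open>\<eta>\<close> exceeding
  \<open>(g \<circ> F)\<^sup>*\<close> at a point would produce, by separating that point from the convex set \<open>epi \<eta>\<close>, an affine
  minorant of \<open>\<eta>\<close>; its slope \<open>x\<close> is a point at which \<open>g \<circ> F\<close> is too small. Under the condition of (b),
  a \<open>v\<close> attaining the infimum is a Lagrange multiplier, namely a subgradient at the origin of a
  perturbed value function whose domain has the origin in its relative interior. Hence
  \<open>\<eta> = (g \<circ> F)\<^sup>*\<close> there, and \<open>\<eta>\<close> inherits closedness and convexity from the conjugate.\<close>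

section \<open>Affine minorants\<close>

text \<open>The feature of epigraphs that the separation arguments use. It also fits the value set
  of a perturbed problem, which need not be the epigraph of a function because infima over it may
  not be attained.\<close>

definition upward_closed :: "('a \<times> real) set \<Rightarrow> bool" where
  "upward_closed S \<longleftrightarrow> (\<forall>u r s. (u, r) \<in> S \<longrightarrow> r \<le> s \<longrightarrow> (u, s) \<in> S)"

lemma upward_closedD: "upward_closed S \<Longrightarrow> (u, r) \<in> S \<Longrightarrow> r \<le> s \<Longrightarrow> (u, s) \<in> S"
  unfolding upward_closed_def by blast

text \<open>The bottom \<open>(u0, m')\<close> of the fibre over \<open>u0\<close> is in the closure
  of \<open>S\<close> but not in its relative interior, so a hyperplane supports \<open>S\<close>
  there. As \<open>u0\<close> is relatively interior to the projection, this hyperplane is not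
  vertical, hence the graph of an affine function.\<close>

lemma convex_set_supporting_affine:
  fixes S :: "('a::euclidean_space \<times> real) set"
  assumes cS: "convex S"
    and up: "upward_closed S"
    and ri: "u0 \<in> rel_interior (fst ` S)"
    and low: "\<And>r. (u0, r) \<in> S \<Longrightarrow> m \<le> r"
  shows "\<exists>v. \<forall>(u, r) \<in> S. m + v \<bullet> (u - u0) \<le> r"
proof -
  define R where "R = {r. (u0, r) \<in> S}"
  define m' where "m' = Inf R"
  have "u0 \<in> fst ` S"
    using ri rel_interior_subset by blast
  then have Rne: "R \<noteq> {}"
    by (auto simp: R_def)
  have bdd: "bdd_below R"
    using low by (auto simp: R_def bdd_below_def)
  have mm': "m \<le> m'"
    unfolding m'_def using Rne low by (intro cInf_greatest) (auto simp: R_def)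
  have m'le: "m' \<le> r" if "(u0, r) \<in> S" for r
    unfolding m'_def using that bdd by (intro cInf_lower) (auto simp: R_def)
  have above: "(u0, m' + e) \<in> S" if "e > 0" for e
  proof -
    have "\<exists>r\<in>R. r < m' + e"
      using cInf_lessD[of R "m' + e"] Rne that by (auto simp: m'_def)
    then obtain r where "r \<in> R" "r < m' + e" by blast
    then show ?thesis
      using upward_closedD[OF up, of u0 r "m' + e"] by (auto simp: R_def)
  qed
  have cl: "(u0, m') \<in> closure S"
    unfolding closure_approachable
  proof (intro allI impI)
    fix e :: real assume "e > 0"
    then show "\<exists>y\<in>S. dist y (u0, m') < e"
      using above[of "e/2"] by (intro bexI[of _ "(u0, m' + e/2)"]) (auto simp: dist_prod_def dist_real_def)
  qed
  \<comment> \<open>Otherwise the vertical segment from \<open>(u0, m' + 1)\<close> could be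
    prolonged inside \<open>S\<close> below height \<open>m'\<close>.\<close>
  have nri: "(u0, m') \<notin> rel_interior S"
  proof
    assume a: "(u0, m') \<in> rel_interior S"
    have ne: "S \<noteq> {}" using above[of 1] by auto
    obtain e where e: "e > 1" "(1 - e) *\<^sub>R (u0, m' + 1) + e *\<^sub>R (u0, m') \<in> S"
      using convex_rel_interior_iff[OF cS ne, of "(u0, m')"] a above[of 1] by auto
    have "(1 - e) *\<^sub>R (u0, m' + 1) + e *\<^sub>R (u0, m') = (u0, m' + (1 - e))"
      by (simp add: algebra_simps)
    then show False
      using m'le[of "m' + (1 - e)"] e by auto
  qed
  obtain ab where "ab \<noteq> 0"
    and le0: "\<And>y. y \<in> closure S \<Longrightarrow> ab \<bullet> (u0, m') \<le> ab \<bullet> y"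
    and lt0: "\<And>y. y \<in> rel_interior S \<Longrightarrow> ab \<bullet> (u0, m') < ab \<bullet> y"
    using supporting_hyperplane_relative_frontier[OF cS cl nri] by blast
  obtain a b where ab: "ab = (a, b)" by fastforce
  have le: "a \<bullet> u0 + b * m' \<le> a \<bullet> u + b * r" if "(u, r) \<in> S" for u r
    using le0[of "(u, r)"] that closure_subset by (auto simp: ab)
  have "b \<ge> 0"
    using le[OF above[of 1]] by (simp add: algebra_simps)
  \<comment> \<open>A vertical hyperplane contradicts the strict inequality \<open>lt0\<close>:
    prolonging from a relative interior point of \<open>S\<close> past \<open>u0\<close> in the
    projection gives the reverse inequality.\<close>
  moreover have "b \<noteq> 0"
  proof
    assume b: "b = 0"
    have ne: "S \<noteq> {}" using above[of 1] by auto
    then obtain u r where ur: "(u, r) \<in> rel_interior S"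
      using rel_interior_eq_empty[OF cS] by fastforce
    then have urS: "(u, r) \<in> S" using rel_interior_subset by blast
    have cf: "convex (fst ` S)"
      using cS by (intro convex_linear_image) (auto intro: linearI)
    obtain e where e: "e > 1" "(1 - e) *\<^sub>R u + e *\<^sub>R u0 \<in> fst ` S"
      using convex_rel_interior_iff[OF cf, of u0] ne ri urS by force
    then obtain s where "((1 - e) *\<^sub>R u + e *\<^sub>R u0, s) \<in> S" by auto
    from le[OF this] have "(e - 1) * (a \<bullet> u) \<le> (e - 1) * (a \<bullet> u0)"
      by (simp add: b inner_add_right algebra_simps)
    then have "a \<bullet> u \<le> a \<bullet> u0" using e by simp
    with lt0[OF ur] show False by (simp add: ab b)
  qed
  ultimately have b: "b > 0" by simp
  show ?thesis
  proof (intro exI[of _ "(-1 / b) *\<^sub>R a"] ballI, clarify)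
    fix u r assume "(u, r) \<in> S"
    from le[OF this] have "b * m' - a \<bullet> (u - u0) \<le> b * r"
      by (simp add: inner_diff_right)
    then have "m' - (a \<bullet> (u - u0)) / b \<le> r"
      using b by (simp add: field_simps)
    then show "m + ((-1 / b) *\<^sub>R a) \<bullet> (u - u0) \<le> r"
      using mm' by simp
  qed
qed

text \<open>The point is strictly separated from the closure of \<open>S\<close>. A non-vertical
  separating hyperplane is the required affine minorant; a vertical one is used to tilt the given
  minorant until it passes above the point.\<close>

lemma affine_minorant_separating_point:
  fixes S :: "('a::euclidean_space \<times> real) set"
  assumes cS: "convex S"
    and up: "upward_closed S"
    and min0: "\<And>z r. (z, r) \<in> S \<Longrightarrow> y0 \<bullet> z - \<beta>0 \<le> r"
    and out: "(x, c) \<notin> closure S"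
  shows "\<exists>y \<beta>. (\<forall>(z, r) \<in> S. y \<bullet> z - \<beta> \<le> r) \<and> c < y \<bullet> x - \<beta>"
proof (cases "S = {}")
  case True
  then show ?thesis by (intro exI[of _ 0] exI[of _ "- c - 1"]) auto
next
  case False
  obtain ab d where sep0: "ab \<bullet> (x, c) < d" "\<forall>y\<in>closure S. d < ab \<bullet> y"
    using separating_hyperplane_closed_point[of "closure S" "(x, c)"] cS out by auto
  obtain a b where ab: "ab = (a, b)" by fastforce
  have sx: "a \<bullet> x + b * c < d"
    using sep0 by (simp add: ab)
  have sS: "d < a \<bullet> z + b * r" if "(z, r) \<in> S" for z r
    using sep0(2) that closure_subset by (fastforce simp: ab)
  have "b \<ge> 0"
  proof (rule ccontr)
    assume "\<not> b \<ge> 0"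
    then have b: "b < 0" by simp
    obtain z r where zr: "(z, r) \<in> S" using False by auto
    \<comment> \<open>With \<open>b < 0\<close>, points of \<open>S\<close> over \<open>z\<close> at
      this height or above violate the separation.\<close>
    define s where "s = max r ((d - a \<bullet> z) / b)"
    have "b * s \<le> b * ((d - a \<bullet> z) / b)"
      using b by (intro mult_left_mono_neg) (auto simp: s_def)
    with b have "b * s \<le> d - a \<bullet> z" by simp
    with sS[OF upward_closedD[OF up zr, of s]] show False by (simp add: s_def)
  qed
  then consider "b > 0" | "b = 0" by linarith
  then show ?thesis
  proof cases
    case 1
    show ?thesis
    proof (intro exI[of _ "(-1 / b) *\<^sub>R a"] exI[of _ "- d / b"] conjI ballI, clarify)
      fix z r assume "(z, r) \<in> S"
      from sS[OF this] 1 show "((-1 / b) *\<^sub>R a) \<bullet> z - (- d / b) \<le> r"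
        by (simp add: field_simps)
    next
      show "c < ((-1 / b) *\<^sub>R a) \<bullet> x - (- d / b)"
        using sx 1 by (simp add: field_simps)
    qed
  next
    case 2
    \<comment> \<open>The tilt gains \<open>t * (d - a \<bullet> x)\<close> at \<open>x\<close>, one
      more than the possible deficit of the given minorant below \<open>c\<close>, while over
      \<open>S\<close> it only lowers the minorant.\<close>
    define t where "t = (\<bar>c - (y0 \<bullet> x - \<beta>0)\<bar> + 1) / (d - a \<bullet> x)"
    have pos: "d - a \<bullet> x > 0" using sx 2 by simp
    then have l0: "t \<ge> 0" by (simp add: t_def)
    have lx: "t * (d - a \<bullet> x) = \<bar>c - (y0 \<bullet> x - \<beta>0)\<bar> + 1"
      using pos by (simp add: t_def)
    show ?thesis
    proof (intro exI[of _ "y0 - t *\<^sub>R a"] exI[of _ "\<beta>0 - t * d"] conjI ballI, clarify)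
      fix z r assume zr: "(z, r) \<in> S"
      have "t * (d - a \<bullet> z) \<le> 0"
        using sS[OF zr] l0 2 by (intro mult_nonneg_nonpos) auto
      with min0[OF zr] show "(y0 - t *\<^sub>R a) \<bullet> z - (\<beta>0 - t * d) \<le> r"
        by (simp add: inner_diff_left algebra_simps)
    next
      show "c < (y0 - t *\<^sub>R a) \<bullet> x - (\<beta>0 - t * d)"
        using lx by (simp add: inner_diff_left algebra_simps)
    qed
  qed
qed

section \<open>Extended real-valued functions\<close>

lemma mem_epi [simp]: "(x, r) \<in> epi f \<longleftrightarrow> f x \<le> ereal r"
  by (simp add: epi_def)

lemma upward_closed_epi: "upward_closed (epi f)"
  by (auto simp: upward_closed_def intro: order_trans)

lemma fst_epi: "fst ` epi f = edom f"
proof -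
  have "\<exists>r. f x \<le> ereal r" if "f x < \<infinity>" for x
    using that by (cases "f x") auto
  moreover have "x \<in> fst ` epi f \<longleftrightarrow> (\<exists>r. f x \<le> ereal r)" for x
    unfolding image_iff Bex_def split_paired_Ex by simp
  ultimately show ?thesis
    by (auto simp: edom_def intro: le_less_trans)
qed

lemma edomE:
  assumes "proper_fun f" "x \<in> edom f"
  obtains r where "f x = ereal r"
  using assms by (cases "f x") (auto simp: proper_fun_def edom_def)

lemma closed_epi:
  assumes "lsc_fun f"
  shows "closed (epi f)"
proof -
  have "\<exists>T. open T \<and> z \<in> T \<and> T \<subseteq> - epi f" if "z \<in> - epi f" for z
  proof -
    obtain x r where z: "z = (x, r)" by fastforce
    with that have "ereal r < f x" by simp
    \<comment> \<open>A level strictly between leaves vertical room, so that a whole box around the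
      point misses the epigraph.\<close>
    then obtain q where q: "ereal r < ereal q" "ereal q < f x"
      using ereal_dense2 by blast
    from q(2) assms have "ereal q < Liminf (nhds x) f"
      unfolding lsc_fun_def by (blast intro: less_le_trans)
    then have "\<forall>\<^sub>F y in nhds x. ereal q < f y"
      by (rule less_LiminfD)
    then obtain U where U: "open U" "x \<in> U" "\<And>y. y \<in> U \<Longrightarrow> ereal q < f y"
      by (auto simp: eventually_nhds)
    have "f y > ereal s" if "y \<in> U" "s < q" for y s
      using U(3)[OF that(1)] that(2) by (meson ereal_less_le less_imp_le less_trans less_ereal.simps(1))
    then have "U \<times> {..<q} \<subseteq> - epi f"
      by (force dest: leD)
    moreover have "z \<in> U \<times> {..<q}" using U q z by simp
    moreover have "open (U \<times> {..<q})" using U by (intro open_Times) auto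
    ultimately show ?thesis by blast
  qed
  then have "open (- epi f)"
    using open_subopen by blast
  then show ?thesis by (simp add: closed_def)
qed

text \<open>Replaces arithmetic in \<open>ereal\<close> by real inequalities over the epigraph. A
  value -\<infinity> of \<open>f\<close> puts a whole vertical line into \<open>epi f\<close> and so
  excludes every real bound, as it should.\<close>

lemma fenchel_conjugate_le_iff:
  "fenchel_conjugate f y \<le> ereal R \<longleftrightarrow> (\<forall>(x, r) \<in> epi f. y \<bullet> x - r \<le> R)"
proof -
  have "ereal (y \<bullet> x) - f x \<le> ereal R \<longleftrightarrow> (\<forall>r. f x \<le> ereal r \<longrightarrow> y \<bullet> x - r \<le> R)" for x
  proof (cases "f x")
    case (real s)
    then show ?thesis by (auto intro: order_trans[rotated])
  next
    case MInf
    then show ?thesis by (auto intro!: exI[of _ "y \<bullet> x - R - 1"])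
  qed auto
  then show ?thesis
    unfolding fenchel_conjugate_def epi_def by (simp add: SUP_le_iff)
qed

lemma fenchel_conjugate_gt_minus_infinity:
  assumes "edom f \<noteq> {}"
  shows "fenchel_conjugate f y \<noteq> - \<infinity>"
proof
  assume a: "fenchel_conjugate f y = - \<infinity>"
  obtain x r where xr: "(x, r) \<in> epi f"
    using assms fst_epi[of f] by fastforce
  have "fenchel_conjugate f y \<le> ereal (y \<bullet> x - r - 1)"
    by (simp add: a)
  then show False
    using xr unfolding fenchel_conjugate_le_iff by fastforce
qed

text \<open>An intersection of closed half-spaces, from which convexity and closedness of the
  conjugate are immediate.\<close>

lemma epi_fenchel_conjugate:
  "epi (fenchel_conjugate f) = (\<Inter>(x, r) \<in> epi f. {z. (x, -1) \<bullet> z \<le> r})"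
proof (rule set_eqI)
  fix z :: "'a \<times> real"
  obtain p R where "z = (p, R)" by fastforce
  then show "z \<in> epi (fenchel_conjugate f) \<longleftrightarrow> z \<in> (\<Inter>(x, r) \<in> epi f. {z. (x, -1) \<bullet> z \<le> r})"
    by (auto simp: fenchel_conjugate_le_iff inner_commute algebra_simps)
qed

lemma convex_fun_fenchel_conjugate: "convex_fun (fenchel_conjugate f)"
  unfolding convex_fun_def epi_fenchel_conjugate
  by (intro convex_INT) (auto intro: convex_halfspace_le)

lemma closed_fun_fenchel_conjugate: "closed_fun (fenchel_conjugate f)"
  unfolding closed_fun_def epi_fenchel_conjugate
  by (intro closed_INT) (auto intro: closed_halfspace_le)

lemma lsc_fun_fenchel_conjugate: "lsc_fun (fenchel_conjugate f)"
  unfolding lsc_fun_def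
proof
  fix p
  show "fenchel_conjugate f p \<le> Liminf (nhds p) (fenchel_conjugate f)"
    unfolding le_Liminf_iff
  proof (intro allI impI)
    fix c assume "c < fenchel_conjugate f p"
    then obtain x where x: "c < ereal (p \<bullet> x) - f x"
      by (auto simp: fenchel_conjugate_def less_SUP_iff)
    \<comment> \<open>The conjugate is a supremum of functions continuous in the slope; where
      \<open>f x\<close> is infinite the function in question is constant.\<close>
    have "((\<lambda>q. ereal (q \<bullet> x) - f x) \<longlongrightarrow> ereal (p \<bullet> x) - f x) (nhds p)"
    proof (cases "f x")
      case (real r)
      have "((\<lambda>q. ereal (q \<bullet> x - r)) \<longlongrightarrow> ereal (p \<bullet> x - r)) (nhds p)"
        by (intro tendsto_intros filterlim_ident)
      then show ?thesis by (simp add: real)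
    qed auto
    then have "\<forall>\<^sub>F q in nhds p. c < ereal (q \<bullet> x) - f x"
      using x by (rule order_tendstoD(1))
    then show "\<forall>\<^sub>F q in nhds p. c < fenchel_conjugate f q"
      by (rule eventually_mono)
        (auto simp: fenchel_conjugate_def less_SUP_iff)
  qed
qed

text \<open>The epigraph is supported over a relative interior point of the effective domain, where
  the value is real.\<close>

lemma Gamma_fun_affine_minorant:
  fixes f :: "'a::euclidean_space \<Rightarrow> ereal"
  assumes "f \<in> Gamma_fun"
  obtains y \<beta> where "\<And>x r. (x, r) \<in> epi f \<Longrightarrow> y \<bullet> x - \<beta> \<le> r"
proof -
  have f: "proper_fun f" "convex (epi f)"
    using assms by (auto simp: Gamma_fun_def convex_fun_def)
  have "convex (edom f)"
    unfolding fst_epi[symmetric] using f(2)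
    by (intro convex_linear_image) (auto intro: linearI)
  then obtain x0 where x0: "x0 \<in> rel_interior (edom f)"
    using f(1) rel_interior_eq_empty unfolding proper_fun_def by blast
  then obtain m where m: "f x0 = ereal m"
    using edomE[OF f(1)] rel_interior_subset by blast
  obtain v where v: "\<forall>(u, r) \<in> epi f. m + v \<bullet> (u - x0) \<le> r"
    using convex_set_supporting_affine[OF f(2) upward_closed_epi, of x0 m] x0 m
    by (auto simp: fst_epi)
  show ?thesis
    using v by (intro that[of v "v \<bullet> x0 - m"]) (auto simp: inner_diff_right algebra_simps)
qed

lemma proper_fun_fenchel_conjugate:
  fixes f :: "'a::euclidean_space \<Rightarrow> ereal"
  assumes "f \<in> Gamma_fun"
  shows "proper_fun (fenchel_conjugate f)"
proof -
  obtain y \<beta> where "\<And>x r. (x, r) \<in> epi f \<Longrightarrow> y \<bullet> x - \<beta> \<le> r"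
    using Gamma_fun_affine_minorant[OF assms] by blast
  then have "fenchel_conjugate f y \<le> ereal \<beta>"
    unfolding fenchel_conjugate_le_iff by fastforce
  then have "fenchel_conjugate f y < \<infinity>"
    by (auto intro: le_less_trans)
  moreover have "edom f \<noteq> {}"
    using assms by (simp add: Gamma_fun_def proper_fun_def)
  ultimately show ?thesis
    using fenchel_conjugate_gt_minus_infinity unfolding proper_fun_def edom_def by blast
qed

text \<open>The Fenchel--Moreau theorem, in the form \<open>f \<le> f\<^sup>*\<^sup>*\<close>.\<close>

lemma Gamma0_fun_conjugate_approx:
  fixes f :: "'a::euclidean_space \<Rightarrow> ereal"
  assumes f: "f \<in> Gamma0_fun" and c: "ereal c < f x"
  obtains y \<beta> where "fenchel_conjugate f y \<le> ereal \<beta>" "c < y \<bullet> x - \<beta>"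
proof -
  have G: "f \<in> Gamma_fun" "closed (epi f)"
    using f closed_epi by (auto simp: Gamma0_fun_def)
  obtain y0 \<beta>0 where "\<And>x r. (x, r) \<in> epi f \<Longrightarrow> y0 \<bullet> x - \<beta>0 \<le> r"
    using Gamma_fun_affine_minorant[OF G(1)] by blast
  moreover have "convex (epi f)"
    using G by (simp add: Gamma_fun_def convex_fun_def)
  moreover have "(x, c) \<notin> closure (epi f)"
    using c G by simp
  ultimately obtain y \<beta> where y: "\<forall>(z, r) \<in> epi f. y \<bullet> z - \<beta> \<le> r" "c < y \<bullet> x - \<beta>"
    using affine_minorant_separating_point[OF _ upward_closed_epi] by blast
  show ?thesis
  proof (rule that[of y \<beta>])
    show "fenchel_conjugate f y \<le> ereal \<beta>"
      unfolding fenchel_conjugate_le_iff using y(1) by fastforce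
  qed (fact y(2))
qed

section \<open>Composition with a cone-convex map\<close>

lemma epi_ext_compose: "(x, r) \<in> epi (ext_compose g F) \<longleftrightarrow> x \<in> dom F \<and> g (the (F x)) \<le> ereal r"
  by (auto simp: ext_compose_def split: option.splits)

lemma epi_scalarize: "(x, r) \<in> epi (scalarize v F) \<longleftrightarrow> x \<in> dom F \<and> v \<bullet> the (F x) \<le> r"
  unfolding scalarize_def epi_ext_compose by simp

lemma cone_epiI: "x \<in> dom F \<Longrightarrow> k \<in> K \<Longrightarrow> (x, the (F x) + k) \<in> cone_epi K F"
  by (simp add: cone_epi_def)

lemma fenchel_conjugate_scalarize_neq:
  assumes "dom F \<noteq> {}"
  shows "fenchel_conjugate (scalarize v F) p \<noteq> - \<infinity>"
proof (rule fenchel_conjugate_gt_minus_infinity)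
  obtain x where "(x, v \<bullet> the (F x)) \<in> epi (scalarize v F)"
    using assms unfolding epi_scalarize by blast
  then show "edom (scalarize v F) \<noteq> {}"
    unfolding fst_epi[symmetric] by blast
qed

text \<open>The two suprema run over independent variables and neither is -\<infinity>, so bounding
  their sum means bounding all sums of terms. The resulting inequalities are jointly affine in
  \<open>v\<close> and \<open>p\<close>.\<close>

lemma conjugate_sum_le_iff:
  assumes "edom g \<noteq> {}" "dom F \<noteq> {}"
  shows "fenchel_conjugate g v + fenchel_conjugate (scalarize v F) p \<le> ereal R \<longleftrightarrow>
    (\<forall>(y, r) \<in> epi g. \<forall>x \<in> dom F. v \<bullet> y - r + p \<bullet> x - v \<bullet> the (F x) \<le> R)"
    (is "?A + ?B \<le> _ \<longleftrightarrow> ?rhs")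
proof
  have A: "?A \<noteq> - \<infinity>" using assms by (simp add: fenchel_conjugate_gt_minus_infinity)
  have B: "?B \<noteq> - \<infinity>" using assms by (simp add: fenchel_conjugate_scalarize_neq)
  {
    assume le: "?A + ?B \<le> ereal R"
    then obtain \<alpha> \<beta> where ab: "?A = ereal \<alpha>" "?B = ereal \<beta>"
      using A B by (cases ?A; cases ?B) auto
    have "v \<bullet> y - r \<le> \<alpha>" if "(y, r) \<in> epi g" for y r
      using ab(1) that fenchel_conjugate_le_iff[of g v \<alpha>] by fastforce
    moreover have "p \<bullet> x - v \<bullet> the (F x) \<le> \<beta>" if "x \<in> dom F" for x
      using ab(2) that fenchel_conjugate_le_iff[of "scalarize v F" p \<beta>]
        epi_scalarize[of x "v \<bullet> the (F x)" v F] by fastforce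
    ultimately show ?rhs
      using le ab by fastforce
  }
  assume r: ?rhs
  obtain y0 r0 where y0: "(y0, r0) \<in> epi g"
    using assms fst_epi[of g] by fastforce
  \<comment> \<open>The supremum over \<open>x\<close> is taken first, with the point of
    \<open>epi g\<close> fixed. This makes the second conjugate real, and it can then be moved to
    the other side.\<close>
  have *: "?B \<le> ereal (R - (v \<bullet> y - s))" if ys: "(y, s) \<in> epi g" for y s
    unfolding fenchel_conjugate_le_iff
  proof (clarify)
    fix x r' assume "(x, r') \<in> epi (scalarize v F)"
    then have "x \<in> dom F" "v \<bullet> the (F x) \<le> r'"
      unfolding epi_scalarize by auto
    moreover from this(1) have "v \<bullet> y - s + p \<bullet> x - v \<bullet> the (F x) \<le> R"
      using r ys by blast
    ultimately show "p \<bullet> x - r' \<le> R - (v \<bullet> y - s)" by linarith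
  qed
  from *[OF y0] B obtain \<beta> where b: "?B = ereal \<beta>" by (cases ?B) auto
  have "?A \<le> ereal (R - \<beta>)"
    unfolding fenchel_conjugate_le_iff
  proof (clarify)
    fix y s assume ys: "(y, s) \<in> epi g"
    from *[OF ys] show "v \<bullet> y - s \<le> R - \<beta>" by (simp add: b)
  qed
  then show "?A + ?B \<le> ereal R"
    by (cases ?A) (auto simp: b)
qed

text \<open>Weak duality: for \<open>y = F x\<close> the terms with \<open>v\<close> cancel in the
  joint inequalities.\<close>

lemma conjugate_compose_le_sum:
  assumes "edom g \<noteq> {}" "dom F \<noteq> {}"
  shows "fenchel_conjugate (ext_compose g F) p
    \<le> fenchel_conjugate g v + fenchel_conjugate (scalarize v F) p"
proof (rule ereal_le_real)
  fix R
  assume "fenchel_conjugate g v + fenchel_conjugate (scalarize v F) p \<le> ereal R"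
  then have *: "v \<bullet> y - r + p \<bullet> x - v \<bullet> the (F x) \<le> R" if "(y, r) \<in> epi g" "x \<in> dom F" for y r x
    unfolding conjugate_sum_le_iff[OF assms] using that by blast
  show "fenchel_conjugate (ext_compose g F) p \<le> ereal R"
    unfolding fenchel_conjugate_le_iff
  proof (clarify)
    fix x r assume "(x, r) \<in> epi (ext_compose g F)"
    then have "(the (F x), r) \<in> epi g" "x \<in> dom F"
      unfolding epi_ext_compose by auto
    from *[OF this] show "p \<bullet> x - r \<le> R" by simp
  qed
qed

section \<open>The function \<open>eta\<close> and its lower semicontinuous hull\<close>

lemma conjugate_compose_le_eta:
  assumes "edom g \<noteq> {}" "dom F \<noteq> {}"
  shows "fenchel_conjugate (ext_compose g F) p \<le> eta K g F p"
  unfolding eta_def using conjugate_compose_le_sum[OF assms] by (intro INF_greatest)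

lemma mem_uminus_polar: "v \<in> uminus ` polar K \<longleftrightarrow> (\<forall>k\<in>K. 0 \<le> v \<bullet> k)"
proof
  assume "\<forall>k\<in>K. 0 \<le> v \<bullet> k"
  then have "- v \<in> polar K" by (simp add: polar_def)
  then show "v \<in> uminus ` polar K" by (metis image_eqI minus_minus)
qed (auto simp: polar_def)

text \<open>The sum of conjugates is jointly convex in \<open>v\<close> and \<open>p\<close>, and
  \<open>eta\<close> is its infimum over \<open>v\<close> in a convex cone. Since that infimum may
  not be attained, multipliers are chosen up to \<open>e\<close>.\<close>

lemma convex_fun_eta:
  assumes g: "edom g \<noteq> {}" and F: "dom F \<noteq> {}"
  shows "convex_fun (eta K g F)"
  unfolding convex_fun_def convex_def
proof (clarsimp)
  fix p1 p2 :: 'b and r1 r2 s t :: real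
  assume r: "eta K g F p1 \<le> ereal r1" "eta K g F p2 \<le> ereal r2"
    and st: "0 \<le> s" "0 \<le> t" "s + t = 1"
  show "eta K g F (s *\<^sub>R p1 + t *\<^sub>R p2) \<le> ereal (s * r1 + t * r2)"
  proof (rule ereal_le_epsilon2)
    fix e :: real assume "e > 0"
    have approx: thesis
      if "eta K g F p \<le> ereal r"
        and *: "\<And>v. v \<in> uminus ` polar K \<Longrightarrow>
          \<forall>(y, q) \<in> epi g. \<forall>x \<in> dom F. v \<bullet> y - q + p \<bullet> x - v \<bullet> the (F x) \<le> r + e \<Longrightarrow> thesis"
      for p r thesis
    proof -
      have "eta K g F p < ereal (r + e)"
        using that \<open>e > 0\<close> by (auto intro: le_less_trans)
      then obtain v where "v \<in> uminus ` polar K"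
        "fenchel_conjugate g v + fenchel_conjugate (scalarize v F) p \<le> ereal (r + e)"
        unfolding eta_def INF_less_iff by (meson less_imp_le)
      then show ?thesis
        unfolding conjugate_sum_le_iff[OF g F] by (rule *)
    qed
    obtain v1 where v1: "v1 \<in> uminus ` polar K"
      and le1: "\<forall>(y, q) \<in> epi g. \<forall>x \<in> dom F. v1 \<bullet> y - q + p1 \<bullet> x - v1 \<bullet> the (F x) \<le> r1 + e"
      by (rule approx[OF r(1)])
    obtain v2 where v2: "v2 \<in> uminus ` polar K"
      and le2: "\<forall>(y, q) \<in> epi g. \<forall>x \<in> dom F. v2 \<bullet> y - q + p2 \<bullet> x - v2 \<bullet> the (F x) \<le> r2 + e"
      by (rule approx[OF r(2)])
    define v where "v = s *\<^sub>R v1 + t *\<^sub>R v2"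
    have "v \<in> uminus ` polar K"
      using v1 v2 st unfolding mem_uminus_polar by (auto simp: v_def inner_add_left)
    moreover have "fenchel_conjugate g v
        + fenchel_conjugate (scalarize v F) (s *\<^sub>R p1 + t *\<^sub>R p2) \<le> ereal (s * r1 + t * r2 + e)"
      unfolding conjugate_sum_le_iff[OF g F]
    proof (clarify)
      fix y r x z assume a: "(y, r) \<in> epi g" "F x = Some z"
      then have x: "x \<in> dom F" by auto
      \<comment> \<open>The left side counts \<open>- r\<close> once, the combination
        \<open>s + t\<close> times; the last summand corrects this and vanishes.\<close>
      have "v \<bullet> y - r + (s *\<^sub>R p1 + t *\<^sub>R p2) \<bullet> x - v \<bullet> the (F x)
          = s * (v1 \<bullet> y - r + p1 \<bullet> x - v1 \<bullet> the (F x)) + t * (v2 \<bullet> y - r + p2 \<bullet> x - v2 \<bullet> the (F x))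
            + (s + t - 1) * r"
        by (simp add: v_def inner_add_left algebra_simps)
      also have "\<dots> \<le> s * (r1 + e) + t * (r2 + e)"
        using bspec[OF le1 a(1)] bspec[OF le2 a(1)] x st by (simp add: add_mono mult_left_mono)
      also have "\<dots> = s * r1 + t * r2 + (s + t) * e"
        by (simp add: algebra_simps)
      finally show "v \<bullet> y - r + (s *\<^sub>R p1 + t *\<^sub>R p2) \<bullet> x - v \<bullet> the (F x) \<le> s * r1 + t * r2 + e"
        using st by simp
    qed
    ultimately show "eta K g F (s *\<^sub>R p1 + t *\<^sub>R p2) \<le> ereal (s * r1 + t * r2) + ereal e"
      unfolding eta_def by (auto intro: INF_lower2)
  qed
qed

text \<open>The epigraph of \<open>h\<close> is closed and contains that of \<open>f\<close>, hence
  its closure.\<close>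

lemma lsc_fun_epi_closure:
  assumes "lsc_fun h" "h \<le> f" "ereal c < h x"
  shows "(x, c) \<notin> closure (epi f)"
proof
  assume "(x, c) \<in> closure (epi f)"
  moreover have "closure (epi f) \<subseteq> epi h"
    using assms(2) by (intro closure_minimal closed_epi assms(1))
      (auto simp: epi_def le_fun_def intro: order_trans)
  ultimately have "(x, c) \<in> epi h" by blast
  with assms(3) show False by simp
qed

lemma conjugate_compose_le_lsc_hull_eta:
  assumes "edom g \<noteq> {}" "dom F \<noteq> {}"
  shows "fenchel_conjugate (ext_compose g F) \<le> lsc_hull (eta K g F)"
  unfolding lsc_hull_def using conjugate_compose_le_eta[OF assms]
  by (intro Sup_upper) (auto simp: lsc_fun_fenchel_conjugate le_fun_def)

text \<open>If \<open>v \<bullet> k < 0\<close>, moving from \<open>y\<close> along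
  \<open>- k\<close> does not raise \<open>g\<close> but raises \<open>v \<bullet> y\<close> without
  bound, so the conjugate is infinite at \<open>v\<close>.\<close>

lemma edom_conjugate_cone_increasing:
  fixes g :: "'b::euclidean_space \<Rightarrow> ereal"
  assumes K: "cone K" and g: "edom g \<noteq> {}" "cone_increasing K g"
    and v: "v \<in> edom (fenchel_conjugate g)"
  shows "v \<in> uminus ` polar K"
  unfolding mem_uminus_polar
proof (intro ballI, rule ccontr)
  fix k assume k: "k \<in> K" "\<not> 0 \<le> v \<bullet> k"
  obtain y r where yr: "(y, r) \<in> epi g"
    using g(1) fst_epi[of g] by fastforce
  obtain R where R: "fenchel_conjugate g v \<le> ereal R"
    using v unfolding fst_epi[symmetric] by auto
  define t where "t = (\<bar>R - (v \<bullet> y - r)\<bar> + 1) / - (v \<bullet> k)"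
  have "t \<ge> 0" using k by (simp add: t_def divide_nonneg_neg)
  then have "t *\<^sub>R k \<in> K" using K k by (simp add: cone_def)
  then have "g (y - t *\<^sub>R k) \<le> g y"
    using g(2) by (simp add: cone_increasing_def cone_le_def)
  then have "(y - t *\<^sub>R k, r) \<in> epi g" using yr by auto
  then have "v \<bullet> (y - t *\<^sub>R k) - r \<le> R"
    using R unfolding fenchel_conjugate_le_iff by blast
  then have "v \<bullet> y - r + t * - (v \<bullet> k) \<le> R"
    by (simp add: inner_diff_right)
  moreover have "t * - (v \<bullet> k) = \<bar>R - (v \<bullet> y - r)\<bar> + 1"
    using k by (simp add: t_def)
  ultimately show False by linarith
qed

text \<open>An affine minorant \<open>p \<mapsto> x \<bullet> p - \<beta>\<close> of \<open>\<eta>\<close> says that \<open>\<eta>\<^sup>* x \<le> \<beta>\<close>; biconjugating the scalarizations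
  and \<open>g\<close> turns this into \<open>g (F x) \<le> \<beta>\<close>.\<close>

lemma eta_affine_minorant_compose_le:
  fixes K :: "'b::euclidean_space set"
    and F :: "'a::euclidean_space \<rightharpoonup> 'b"
  assumes K: "cone K"
    and F: "dom F \<noteq> {}" "\<And>v. v \<in> uminus ` polar K \<Longrightarrow> scalarize v F \<in> Gamma0_fun"
    and g: "g \<in> Gamma0_fun" "cone_increasing K g"
    and le: "\<And>p. ereal (x \<bullet> p - \<beta>) \<le> eta K g F p"
  shows "ext_compose g F x \<le> ereal \<beta>"
proof -
  have gG: "g \<in> Gamma_fun" using g by (simp add: Gamma0_fun_def)
  then have gne: "edom g \<noteq> {}" by (simp add: Gamma_fun_def proper_fun_def)
  \<comment> \<open>Finiteness of the conjugate of \<open>g\<close> at \<open>v\<close> already puts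
    \<open>v\<close> in the cone of multipliers. If the bound failed, biconjugating the
    scalarization would give a slope \<open>q\<close> at which the minorant exceeds
    \<open>eta\<close>.\<close>
  have scal: "scalarize v F x \<le> ereal (\<gamma> + \<beta>)" if v: "fenchel_conjugate g v \<le> ereal \<gamma>" for v \<gamma>
  proof (rule ccontr)
    assume "\<not> scalarize v F x \<le> ereal (\<gamma> + \<beta>)"
    then have lt: "ereal (\<gamma> + \<beta>) < scalarize v F x" by simp
    have "v \<in> edom (fenchel_conjugate g)"
      using v by (auto simp: edom_def intro: le_less_trans)
    then have vN: "v \<in> uminus ` polar K"
      using edom_conjugate_cone_increasing[OF K gne g(2)] by blast
    obtain q \<beta>' where q: "fenchel_conjugate (scalarize v F) q \<le> ereal \<beta>'" "\<gamma> + \<beta> < q \<bullet> x - \<beta>'"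
      using Gamma0_fun_conjugate_approx[OF F(2)[OF vN] lt] by blast
    have "ereal (x \<bullet> q - \<beta>) \<le> fenchel_conjugate g v + fenchel_conjugate (scalarize v F) q"
      using le[of q] vN unfolding eta_def by (auto intro: order_trans INF_lower)
    also have "\<dots> \<le> ereal \<gamma> + ereal \<beta>'"
      using v q(1) by (rule add_mono)
    finally show False using q(2) by (simp add: inner_commute)
  qed
  \<comment> \<open>Any single multiplier shows that \<open>x\<close> lies in \<open>dom F\<close>,
    because every scalarization, even with \<open>v = 0\<close>, is +\<infinity> outside it.\<close>
  obtain v0 \<gamma>0 where "fenchel_conjugate g v0 \<le> ereal \<gamma>0"
    using proper_fun_fenchel_conjugate[OF gG] fst_epi[of "fenchel_conjugate g"]
    by (fastforce simp: proper_fun_def)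
  from scal[OF this] have "(x, \<gamma>0 + \<beta>) \<in> epi (scalarize v0 F)" by simp
  then have x: "x \<in> dom F" unfolding epi_scalarize by simp
  have "g (the (F x)) \<le> ereal \<beta>"
  proof (rule ccontr)
    assume "\<not> g (the (F x)) \<le> ereal \<beta>"
    then have "ereal \<beta> < g (the (F x))" by simp
    from Gamma0_fun_conjugate_approx[OF g(1) this] obtain v \<gamma>
      where v: "fenchel_conjugate g v \<le> ereal \<gamma>" "\<beta> < v \<bullet> the (F x) - \<gamma>" by blast
    from scal[OF v(1)] have "(x, \<gamma> + \<beta>) \<in> epi (scalarize v F)" by simp
    then show False using v(2) unfolding epi_scalarize by simp
  qed
  then show ?thesis using x by (auto simp: ext_compose_def)
qed

lemma conjugate_compose_eq_lsc_hull_eta: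
  fixes K :: "'b::euclidean_space set"
    and F :: "'a::euclidean_space \<rightharpoonup> 'b"
  assumes K: "cone K"
    and F: "\<And>v. v \<in> uminus ` polar K \<Longrightarrow> scalarize v F \<in> Gamma0_fun"
    and g: "g \<in> Gamma0_fun" "cone_increasing K g"
    and ne: "ran F \<inter> edom g \<noteq> {}"
  shows "fenchel_conjugate (ext_compose g F) = lsc_hull (eta K g F)"
proof (rule antisym)
  have gne: "edom g \<noteq> {}" and Fne: "dom F \<noteq> {}" using ne by (auto simp: ran_def)
  then show "fenchel_conjugate (ext_compose g F) \<le> lsc_hull (eta K g F)"
    by (rule conjugate_compose_le_lsc_hull_eta)
  \<comment> \<open>A point of the epigraph of the composition yields an affine minorant of
    \<open>eta\<close>, which covers the case of a vertical separating hyperplane.\<close>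
  obtain x1 y1 r1 where 1: "F x1 = Some y1" "(y1, r1) \<in> epi g"
    using ne fst_epi[of g] by (fastforce simp: ran_def)
  then have x1: "(x1, r1) \<in> epi (ext_compose g F)"
    unfolding epi_ext_compose by (auto simp: domI)
  have minor: "x1 \<bullet> p - r1 \<le> r" if "(p, r) \<in> epi (eta K g F)" for p r
  proof -
    have "fenchel_conjugate (ext_compose g F) p \<le> ereal r"
      using conjugate_compose_le_eta[OF gne Fne, of p K] that by auto
    then have "p \<bullet> x1 - r1 \<le> r"
      using x1 unfolding fenchel_conjugate_le_iff by blast
    then show ?thesis by (simp add: inner_commute)
  qed
  have "h p \<le> fenchel_conjugate (ext_compose g F) p" if h: "lsc_fun h" "h \<le> eta K g F" for h p
  proof (rule ccontr)
    assume "\<not> h p \<le> fenchel_conjugate (ext_compose g F) p"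
    then obtain c where c: "fenchel_conjugate (ext_compose g F) p < ereal c" "ereal c < h p"
      using ereal_dense2[of "fenchel_conjugate (ext_compose g F) p" "h p"] by (auto simp: not_le)
    have "convex (epi (eta K g F))"
      using convex_fun_eta[OF gne Fne] by (simp add: convex_fun_def)
    from affine_minorant_separating_point[OF this upward_closed_epi minor lsc_fun_epi_closure[OF h c(2)]]
    obtain x \<beta> where x: "\<forall>(q, r) \<in> epi (eta K g F). x \<bullet> q - \<beta> \<le> r" "c < x \<bullet> p - \<beta>"
      by blast
    have "ereal (x \<bullet> q - \<beta>) \<le> eta K g F q" for q
    proof (rule ereal_le_real)
      fix r assume "eta K g F q \<le> ereal r"
      then have "(q, r) \<in> epi (eta K g F)" by simp
      with x(1) have "x \<bullet> q - \<beta> \<le> r" by blast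
      then show "ereal (x \<bullet> q - \<beta>) \<le> ereal r" by simp
    qed
    \<comment> \<open>The slope \<open>x\<close> now competes in the supremum defining the conjugate
      at \<open>p\<close>, with a term above \<open>c\<close>.\<close>
    from eta_affine_minorant_compose_le[OF K Fne F g this]
    have "(x, \<beta>) \<in> epi (ext_compose g F)" by simp
    moreover have "fenchel_conjugate (ext_compose g F) p \<le> ereal c"
      using c(1) by simp
    ultimately have "p \<bullet> x - \<beta> \<le> c"
      unfolding fenchel_conjugate_le_iff by blast
    with x(2) show False by (simp add: inner_commute)
  qed
  then show "lsc_hull (eta K g F) \<le> fenchel_conjugate (ext_compose g F)"
    unfolding lsc_hull_def by (intro Sup_least) (auto simp: le_fun_def)
qed

section \<open>The qualification condition and the existence of multipliers\<close>

lemma convex_dom_cone_convex: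
  assumes "cone_convex K F" "0 \<in> K"
  shows "convex (dom F)"
proof -
  have "dom F = fst ` cone_epi K F"
  proof (intro equalityI subsetI)
    fix x assume "x \<in> dom F"
    from cone_epiI[OF this assms(2)] show "x \<in> fst ` cone_epi K F" by (rule image_eqI[rotated]) simp
  qed (auto simp: cone_epi_def)
  then show ?thesis
    using assms(1) unfolding cone_convex_def
    by (auto intro!: convex_linear_image linearI)
qed

text \<open>A convex combination of graph points of \<open>F\<close> lies in the
  \<open>K\<close>-epigraph, so \<open>gF\<close> replaces its second component by the value of
  \<open>F\<close>.\<close>

lemma Gamma_fun_ext_compose:
  fixes K :: "'b::real_vector set"
    and F :: "'a::real_vector \<rightharpoonup> 'b"
  assumes K: "0 \<in> K" and F: "cone_convex K F" and g: "g \<in> Gamma_fun"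
    and gF: "\<And>x y. (x, y) \<in> cone_epi K F \<Longrightarrow> g (the (F x)) \<le> g y"
    and x0: "(x0, y0) \<in> cone_epi K F" "y0 \<in> edom g"
  shows "ext_compose g F \<in> Gamma_fun"
proof -
  have "g (the (F x0)) < \<infinity>"
    using gF[OF x0(1)] x0(2) by (auto simp: edom_def intro: le_less_trans)
  then have "x0 \<in> edom (ext_compose g F)"
    using x0(1) by (auto simp: edom_def ext_compose_def cone_epi_def)
  moreover have "ext_compose g F x \<noteq> - \<infinity>" for x
    using g by (auto simp: ext_compose_def Gamma_fun_def proper_fun_def split: option.splits)
  moreover have "convex (epi (ext_compose g F))"
    unfolding convex_def
  proof (intro ballI allI impI, clarify)
    fix x1 x2 r1 r2 and s t :: real
    assume a: "(x1, r1) \<in> epi (ext_compose g F)" "(x2, r2) \<in> epi (ext_compose g F)"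
      and st: "0 \<le> s" "0 \<le> t" "s + t = 1"
    let ?x = "s *\<^sub>R x1 + t *\<^sub>R x2" and ?y = "s *\<^sub>R the (F x1) + t *\<^sub>R the (F x2)"
    have a': "x1 \<in> dom F" "(the (F x1), r1) \<in> epi g" "x2 \<in> dom F" "(the (F x2), r2) \<in> epi g"
      using a unfolding epi_ext_compose by auto
    have "s *\<^sub>R (x1, the (F x1)) + t *\<^sub>R (x2, the (F x2)) \<in> cone_epi K F"
      using F a' cone_epiI[OF a'(1) K] cone_epiI[OF a'(3) K] st
      unfolding cone_convex_def by (intro convexD) auto
    then have xy: "(?x, ?y) \<in> cone_epi K F" by simp
    have "s *\<^sub>R (the (F x1), r1) + t *\<^sub>R (the (F x2), r2) \<in> epi g"
      using g a' st unfolding Gamma_fun_def convex_fun_def by (intro convexD) auto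
    then have "g ?y \<le> ereal (s *\<^sub>R r1 + t *\<^sub>R r2)" by simp
    with gF[OF xy] have "g (the (F ?x)) \<le> ereal (s *\<^sub>R r1 + t *\<^sub>R r2)" by (rule order_trans)
    with xy show "s *\<^sub>R (x1, r1) + t *\<^sub>R (x2, r2) \<in> epi (ext_compose g F)"
      by (simp add: epi_ext_compose cone_epi_def del: mem_epi)
  qed
  ultimately show ?thesis
    unfolding Gamma_fun_def proper_fun_def convex_fun_def by blast
qed

text \<open>Transfers the condition at the single point \<open>x0\<close> to the domain of the value
  function. By the prolongation criterion, it suffices to find for each \<open>u\<close> in the set
  a negative multiple of \<open>u\<close> in it.\<close>

lemma zero_in_rel_interior_diff_cone_epi:
  fixes K :: "'b::euclidean_space set"
    and F :: "'a::euclidean_space \<rightharpoonup> 'b"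
  assumes K: "K \<noteq> {}" "cone K" "convex K"
    and F: "cone_convex K F"
    and A: "convex A"
    and x0: "x0 \<in> rel_interior (dom F)"
    and a: "the (F x0) \<in> rel_interior (minkowski_diff A K)"
  shows "0 \<in> rel_interior (minkowski_diff A (snd ` cone_epi K F))" (is "0 \<in> rel_interior ?D")
proof -
  define a where "a = the (F x0)"
  define G where "G = minkowski_diff A K"
  have K0: "0 \<in> K" using K cone_contains_0 by blast
  have Kadd: "k + l \<in> K" if "k \<in> K" "l \<in> K" for k l
    using K that convex_cone[of K] by blast
  have convex_diff: "convex (minkowski_diff A B)" if "convex B" for B
  proof -
    have "minkowski_diff A B = (\<Union>x\<in>A. \<Union>y\<in>B. {x - y})"
      by (auto simp: minkowski_diff_def)
    then show ?thesis using convex_differences[OF A that] by simp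
  qed
  have F': "convex (cone_epi K F)" using F by (simp add: cone_convex_def)
  have cG: "convex G" unfolding G_def by (rule convex_diff) fact
  have cD: "convex ?D"
    by (rule convex_diff) (auto intro!: convex_linear_image linearI F')
  have aG: "a \<in> rel_interior G" using a by (simp add: a_def G_def)
  then have aG': "a \<in> G" using rel_interior_subset by blast
  have GK: "z - k \<in> G" if z: "z \<in> G" and k: "k \<in> K" for z k
  proof -
    obtain y l where "z = y - l" "y \<in> A" "l \<in> K"
      using z by (auto simp: G_def minkowski_diff_def)
    then have "z - k = y - (l + k)" "l + k \<in> K" using Kadd k by auto
    with \<open>y \<in> A\<close> show ?thesis unfolding G_def minkowski_diff_def by blast
  qed
  have AG: "y \<in> G" if "y \<in> A" for y
    using that K0 unfolding G_def minkowski_diff_def by force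
  have x0d: "x0 \<in> dom F" using x0 rel_interior_subset by blast
  have cdom: "convex (dom F)" using convex_dom_cone_convex[OF F K0] .
  have xa: "(x0, a) \<in> cone_epi K F" using cone_epiI[OF x0d K0] by (simp add: a_def)
  have Dne: "?D \<noteq> {}"
    using aG' xa unfolding G_def minkowski_diff_def by force
  show ?thesis
    unfolding convex_rel_interior_iff[OF cD Dne]
  proof
    fix u assume "u \<in> ?D"
    then obtain y x w where u: "u = y - w" and y: "y \<in> A" and xw: "(x, w) \<in> cone_epi K F"
      by (auto simp: minkowski_diff_def)
    have xd: "x \<in> dom F" using xw by (simp add: cone_epi_def)
    obtain e where e: "e > 1" "(1 - e) *\<^sub>R x + e *\<^sub>R x0 \<in> dom F"
      using convex_rel_interior_iff[OF cdom, of x0] x0 xd by auto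
    define s where "s = e - 1"
    \<comment> \<open>Prolongs the segment from \<open>x\<close> past \<open>x0\<close> inside
      \<open>dom F\<close>, so that \<open>x0\<close> is a convex combination of \<open>x'\<close>
      and \<open>x\<close>.\<close>
    define x' where "x' = x0 + s *\<^sub>R (x0 - x)"
    define w' where "w' = the (F x')"
    have s: "s > 0" using e by (simp add: s_def)
    have "x' = (1 - e) *\<^sub>R x + e *\<^sub>R x0" by (simp add: x'_def s_def algebra_simps)
    then have "x' \<in> dom F" using e by simp
    then have x'w': "(x', w') \<in> cone_epi K F"
      using cone_epiI[OF _ K0] by (simp add: w'_def)
    \<comment> \<open>The defect in the convexity inequality of \<open>F\<close> at
      \<open>x0\<close>, scaled by \<open>1 + s\<close>; \<open>K\<close>-convexity places it in
      \<open>K\<close>.\<close>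
    define k where "k = w' + s *\<^sub>R w - (1 + s) *\<^sub>R a"
    have k: "k \<in> K"
    proof -
      have "(1 / (1 + s)) *\<^sub>R (x', w') + (s / (1 + s)) *\<^sub>R (x, w) \<in> cone_epi K F"
        using F' x'w' xw s by (intro convexD) (auto simp: field_simps)
      moreover have "(1 / (1 + s)) *\<^sub>R x' + (s / (1 + s)) *\<^sub>R x = x0"
      proof -
        have "(1 / (1 + s)) *\<^sub>R x' + (s / (1 + s)) *\<^sub>R x = (1 / (1 + s)) *\<^sub>R (x' + s *\<^sub>R x)"
          by (simp add: scaleR_add_right)
        also have "x' + s *\<^sub>R x = (1 + s) *\<^sub>R x0" by (simp add: x'_def algebra_simps)
        finally show ?thesis using s by simp
      qed
      ultimately have "(1 / (1 + s)) *\<^sub>R w' + (s / (1 + s)) *\<^sub>R w - a \<in> K"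
        by (simp add: cone_epi_def a_def)
      then have "(1 + s) *\<^sub>R ((1 / (1 + s)) *\<^sub>R w' + (s / (1 + s)) *\<^sub>R w - a) \<in> K"
        using K(2) s by (simp add: cone_def)
      moreover have "(1 + s) *\<^sub>R ((1 / (1 + s)) *\<^sub>R w' + (s / (1 + s)) *\<^sub>R w - a) = k"
        using s by (simp add: k_def scaleR_diff_right scaleR_add_right)
      ultimately show ?thesis by simp
    qed
    \<comment> \<open>Chosen so that \<open>a + t *\<^sub>R d\<close> minus
      \<open>(1 - t) *\<^sub>R a + t *\<^sub>R w'\<close> equals
      \<open>- ((t * s) *\<^sub>R u)\<close>. The point \<open>q\<close>, a step against
      \<open>d\<close>, is a convex combination of \<open>a - k\<close> and \<open>y\<close>, hence
      in \<open>G\<close>; prolonging from \<open>q\<close> past \<open>a\<close> gives a step along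
      \<open>d\<close>.\<close>
    define d where "d = k + s *\<^sub>R (a - y)"
    define q where "q = a - (1 / (1 + s)) *\<^sub>R d"
    have "q = (1 / (1 + s)) *\<^sub>R (a - k) + (s / (1 + s)) *\<^sub>R y"
    proof -
      have "q = (1 / (1 + s)) *\<^sub>R ((1 + s) *\<^sub>R a - d)"
        using s by (simp add: q_def scaleR_diff_right)
      also have "(1 + s) *\<^sub>R a - d = (a - k) + s *\<^sub>R y"
        by (simp add: d_def algebra_simps)
      finally show ?thesis by (simp add: scaleR_add_right)
    qed
    also have "\<dots> \<in> G"
      using cG GK[OF aG' k] AG[OF y] s by (intro convexD) (auto simp: field_simps)
    finally have "q \<in> G" .
    then obtain f where f: "f > 1" "(1 - f) *\<^sub>R q + f *\<^sub>R a \<in> G"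
      using convex_rel_interior_iff[OF cG, of a] aG by auto
    define t' where "t' = (f - 1) / (1 + s)"
    have t': "t' > 0" using f s by (simp add: t'_def)
    have "(1 - f) *\<^sub>R q + f *\<^sub>R a = a + t' *\<^sub>R d"
      by (simp add: q_def t'_def algebra_simps diff_divide_distrib)
    with f have at': "a + t' *\<^sub>R d \<in> G" by simp
    \<comment> \<open>The cap at 1 keeps \<open>w1\<close> and \<open>xt\<close> below convex
      combinations.\<close>
    define t where "t = min 1 t'"
    have t: "0 < t" "t \<le> 1" "t \<le> t'" using t' by (auto simp: t_def)
    have "a + t *\<^sub>R d \<in> G"
    proof -
      have "(1 - t / t') *\<^sub>R a + (t / t') *\<^sub>R (a + t' *\<^sub>R d) \<in> G"
        using cG aG' at' t t' by (intro convexD) auto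
      moreover have "(1 - t / t') *\<^sub>R a + (t / t') *\<^sub>R (a + t' *\<^sub>R d) = a + t *\<^sub>R d"
        using t' by (simp add: algebra_simps)
      ultimately show ?thesis by simp
    qed
    then obtain y' l where yl: "a + t *\<^sub>R d = y' - l" "y' \<in> A" "l \<in> K"
      by (auto simp: G_def minkowski_diff_def)
    define w1 where "w1 = (1 - t) *\<^sub>R a + t *\<^sub>R w'"
    define xt where "xt = (1 - t) *\<^sub>R x0 + t *\<^sub>R x'"
    have "(1 - t) *\<^sub>R (x0, a) + t *\<^sub>R (x', w') \<in> cone_epi K F"
      using F' xa x'w' t by (intro convexD) auto
    then have xt: "xt \<in> dom F" "w1 - the (F xt) \<in> K"
      by (simp_all add: cone_epi_def w1_def xt_def)
    have "w1 + l - the (F xt) \<in> K" using Kadd[OF xt(2) yl(3)] by (simp add: diff_add_eq)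
    with xt(1) have "(xt, w1 + l) \<in> cone_epi K F" by (simp add: cone_epi_def)
    then have "w1 + l \<in> snd ` cone_epi K F" by force
    moreover have "(1 - (1 + t * s)) *\<^sub>R u + (1 + t * s) *\<^sub>R 0 = y' - (w1 + l)"
    proof -
      have "y' - (w1 + l) = (a + t *\<^sub>R d) - w1" unfolding yl(1) by simp
      also have "\<dots> = - ((t * s) *\<^sub>R u)"
        by (simp add: w1_def d_def k_def u algebra_simps)
      finally show ?thesis by simp
    qed
    ultimately have "(1 - (1 + t * s)) *\<^sub>R u + (1 + t * s) *\<^sub>R 0 \<in> ?D"
      using yl(2) by (auto simp: minkowski_diff_def simp del: scaleR_zero_right)
    moreover have "1 + t * s > 1" using t s by simp
    ultimately show "\<exists>e>1. (1 - e) *\<^sub>R u + e *\<^sub>R 0 \<in> ?D" by blast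
  qed
qed

text \<open>The multiplier \<open>v\<close> is a subgradient at the origin of the value function
  \<open>u \<mapsto> inf {g (w + u) - p \<bullet> x | (x, w) \<in> K-epi F}\<close>; its value there is \<open>- (g \<circ> F)\<^sup>* p\<close>
  by the monotonicity hypothesis on \<open>g\<close>.\<close>

lemma conjugate_compose_multiplier:
  fixes K :: "'b::euclidean_space set"
    and F :: "'a::euclidean_space \<rightharpoonup> 'b"
  assumes K: "K \<noteq> {}" "cone K" "convex K"
    and F: "cone_convex K F"
    and g: "g \<in> Gamma_fun"
    and gF: "\<And>x y. (x, y) \<in> cone_epi K F \<Longrightarrow> g (the (F x)) \<le> g y"
    and x0: "x0 \<in> rel_interior (dom F)"
      "the (F x0) \<in> rel_interior (minkowski_diff (edom g) K)"
    and c: "fenchel_conjugate (ext_compose g F) p \<le> ereal c"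
  shows "\<exists>v \<in> uminus ` polar K.
    fenchel_conjugate g v + fenchel_conjugate (scalarize v F) p \<le> ereal c"
proof -
  have K0: "0 \<in> K" using K cone_contains_0 by blast
  have ge: "convex (epi g)" "edom g \<noteq> {}"
    using g by (auto simp: Gamma_fun_def convex_fun_def proper_fun_def)
  have cdom: "convex (edom g)"
    unfolding fst_epi[symmetric] by (intro convex_linear_image ge) (auto intro: linearI)
  have x0d: "x0 \<in> dom F" using x0 rel_interior_subset by blast
  \<comment> \<open>A linear map whose image \<open>S\<close> plays the role of the epigraph of the
    value function; linearity makes \<open>S\<close> convex.\<close>
  define T where "T = (\<lambda>z :: ('b \<times> real) \<times> ('a \<times> 'b).
      (fst (fst z) - snd (snd z), snd (fst z) - p \<bullet> fst (snd z)))"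
  define S where "S = T ` (epi g \<times> cone_epi K F)"
  have SI: "(y - w, r - p \<bullet> x) \<in> S" if "(y, r) \<in> epi g" "(x, w) \<in> cone_epi K F" for y r x w
    unfolding S_def using that by (intro image_eqI[of _ _ "((y, r), (x, w))"]) (auto simp: T_def)
  have SE: "\<exists>y s x w. (y, s) \<in> epi g \<and> (x, w) \<in> cone_epi K F \<and> u = y - w \<and> r = s - p \<bullet> x"
    if "(u, r) \<in> S" for u r
    using that unfolding S_def T_def by fastforce
  have "linear T"
    by (rule linearI) (auto simp: T_def inner_add_right algebra_simps)
  then have cS: "convex S"
    using ge F unfolding S_def cone_convex_def by (intro convex_linear_image convex_Times)
  have up: "upward_closed S"
    unfolding upward_closed_def
  proof (intro allI impI)
    fix u r r' assume "(u, r) \<in> S" "(r::real) \<le> r'"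
    then obtain y s x w where *: "(y, s) \<in> epi g" "(x, w) \<in> cone_epi K F" "u = y - w" "r = s - p \<bullet> x"
      using SE by blast
    from *(1) \<open>r \<le> r'\<close> have "(y, s + (r' - r)) \<in> epi g"
      by (auto intro: upward_closedD[OF upward_closed_epi] simp del: mem_epi)
    from SI[OF this *(2)] show "(u, r') \<in> S"
      by (simp add: *)
  qed
  have "fst ` S = minkowski_diff (edom g) (snd ` cone_epi K F)"
    unfolding S_def T_def minkowski_diff_def fst_epi[symmetric] by force
  then have ri: "0 \<in> rel_interior (fst ` S)"
    using zero_in_rel_interior_diff_cone_epi[OF K F cdom x0] by simp
  \<comment> \<open>At the origin the perturbed problem has \<open>w = y\<close>, and
    \<open>gF\<close> lowers \<open>g y\<close> to \<open>g (F x)\<close>, so the bound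
    \<open>c\<close> on the conjugate applies.\<close>
  have low: "- c \<le> r" if 0: "(0, r) \<in> S" for r
  proof -
    obtain y s x where *: "(y, s) \<in> epi g" "(x, y) \<in> cone_epi K F" "r = s - p \<bullet> x"
      using SE[OF 0] by auto
    have "x \<in> dom F" "g (the (F x)) \<le> ereal s"
      using * gF[OF *(2)] by (auto simp: cone_epi_def)
    then have "(x, s) \<in> epi (ext_compose g F)" unfolding epi_ext_compose by simp
    then have "p \<bullet> x - s \<le> c"
      using c unfolding fenchel_conjugate_le_iff by blast
    then show ?thesis using * by simp
  qed
  obtain v where "\<forall>(u, r) \<in> S. - c + v \<bullet> (u - 0) \<le> r"
    using convex_set_supporting_affine[OF cS up ri low] by blast
  then have v: "v \<bullet> (y - w) + p \<bullet> x \<le> c + r"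
    if "(y, r) \<in> epi g" "(x, w) \<in> cone_epi K F" for y r x w
    using SI[OF that] by fastforce
  show ?thesis
  proof (intro bexI[of _ v])
    \<comment> \<open>Adding \<open>t *\<^sub>R k\<close> to \<open>the (F x0)\<close> stays in the
      \<open>K\<close>-epigraph; if \<open>v \<bullet> k < 0\<close>, a large \<open>t\<close>
      breaks the inequality \<open>v\<close>.\<close>
    show "v \<in> uminus ` polar K"
      unfolding mem_uminus_polar
    proof (intro ballI, rule ccontr)
      fix k assume k: "k \<in> K" "\<not> 0 \<le> v \<bullet> k"
      obtain y r where yr: "(y, r) \<in> epi g"
        using ge(2) fst_epi[of g] by fastforce
      define b where "b = c + r - p \<bullet> x0 - v \<bullet> (y - the (F x0))"
      define t where "t = (\<bar>b\<bar> + 1) / - (v \<bullet> k)"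
      have "t \<ge> 0" using k by (simp add: t_def divide_nonneg_neg)
      then have "t *\<^sub>R k \<in> K" using K k by (simp add: cone_def)
      from v[OF yr cone_epiI[OF x0d this]] have "t * - (v \<bullet> k) \<le> b"
        by (simp add: b_def inner_diff_right inner_add_right)
      moreover have "t * - (v \<bullet> k) = \<bar>b\<bar> + 1"
        using k by (simp add: t_def)
      ultimately show False by linarith
    qed
    have "dom F \<noteq> {}" using x0d by blast
    then show "fenchel_conjugate g v + fenchel_conjugate (scalarize v F) p \<le> ereal c"
      unfolding conjugate_sum_le_iff[OF ge(2) \<open>dom F \<noteq> {}\<close>]
    proof (intro ballI, clarify)
      fix y r x z assume a: "(y, r) \<in> epi g" "F x = Some z"
      then have "x \<in> dom F" by blast
      from v[OF a(1) cone_epiI[OF this K0]]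
      show "v \<bullet> y - r + p \<bullet> x - v \<bullet> the (F x) \<le> c"
        by (simp add: inner_diff_right)
    qed
  qed
qed

section \<open>The claims (a), (b) and (c) from weak duality, separation and multipliers\<close>

theorem theorem12:
  fixes K :: "'b::euclidean_space set"
    and F :: "'a::euclidean_space \<rightharpoonup> 'b"
    and g :: "'b \<Rightarrow> ereal"
  assumes K: "K \<noteq> {}" "cone K" "convex K" "closed K"
    and F: "dom F \<noteq> {}" "cone_convex K F"
    and g: "g \<in> Gamma_fun"
    and gF: "\<forall>(x, y) \<in> cone_epi K F. g (the (F x)) \<le> g y"
  shows
    "fenchel_conjugate (ext_compose g F) \<le> lsc_hull (eta K g F)
     \<and> ((\<forall>v \<in> uminus ` polar K. scalarize v F \<in> Gamma0_fun)
          \<and> lsc_fun g \<and> cone_increasing K g \<and> ran F \<inter> edom g \<noteq> {}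
        \<longrightarrow> fenchel_conjugate (ext_compose g F) = lsc_hull (eta K g F))
     \<and> ((\<lambda>x. the (F x)) ` rel_interior (dom F)
            \<inter> rel_interior (minkowski_diff (edom g) K) \<noteq> {}
        \<longrightarrow> (closed_fun (eta K g F) \<and> proper_fun (eta K g F) \<and> convex_fun (eta K g F)
             \<and> (\<forall>p. \<exists>v \<in> uminus ` polar K.
                  eta K g F p = fenchel_conjugate g v + fenchel_conjugate (scalarize v F) p))
          \<and> (\<forall>p. \<exists>v \<in> uminus ` polar K.
               fenchel_conjugate (ext_compose g F) p
                 = fenchel_conjugate g v + fenchel_conjugate (scalarize v F) p
               \<and> (\<forall>w \<in> uminus ` polar K.
                    fenchel_conjugate g v + fenchel_conjugate (scalarize v F) p
                      \<le> fenchel_conjugate g w + fenchel_conjugate (scalarize w F) p))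
          \<and> edom (fenchel_conjugate (ext_compose g F))
              = {p. \<exists>v \<in> edom (fenchel_conjugate g) \<inter> uminus ` polar K.
                   fenchel_conjugate (scalarize v F) p < \<infinity>})"
proof -
  let ?N = "uminus ` polar K"
  let ?h = "fenchel_conjugate (ext_compose g F)"
  let ?s = "\<lambda>v p. fenchel_conjugate g v + fenchel_conjugate (scalarize v F) p"
  have K0: "0 \<in> K" using K cone_contains_0 by blast
  have N0: "0 \<in> ?N" by (simp add: mem_uminus_polar)
  have ge: "edom g \<noteq> {}" using g by (simp add: Gamma_fun_def proper_fun_def)
  have gF': "g (the (F x)) \<le> g y" if "(x, y) \<in> cone_epi K F" for x y
    using gF that by auto
  note le = conjugate_compose_le_sum[OF ge F(1)]
  have a1: "?h \<le> lsc_hull (eta K g F)"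
    using conjugate_compose_le_lsc_hull_eta[OF ge F(1)] .
  have a2: "?h = lsc_hull (eta K g F)"
    if "\<forall>v \<in> ?N. scalarize v F \<in> Gamma0_fun" "lsc_fun g" "cone_increasing K g" "ran F \<inter> edom g \<noteq> {}"
    using that g by (intro conjugate_compose_eq_lsc_hull_eta[OF K(2)]) (auto simp: Gamma0_fun_def)
  have bc: "closed_fun (eta K g F) \<and> proper_fun (eta K g F) \<and> convex_fun (eta K g F)
      \<and> (\<forall>p. \<exists>v \<in> ?N. eta K g F p = ?s v p)"
    "\<forall>p. \<exists>v \<in> ?N. ?h p = ?s v p \<and> (\<forall>w \<in> ?N. ?s v p \<le> ?s w p)"
    "edom ?h = {p. \<exists>v \<in> edom (fenchel_conjugate g) \<inter> ?N. fenchel_conjugate (scalarize v F) p < \<infinity>}"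
    if Q: "(\<lambda>x. the (F x)) ` rel_interior (dom F) \<inter> rel_interior (minkowski_diff (edom g) K) \<noteq> {}"
  proof -
    obtain x0 where x0: "x0 \<in> rel_interior (dom F)"
      "the (F x0) \<in> rel_interior (minkowski_diff (edom g) K)"
      using Q by blast
    then have "x0 \<in> dom F" "the (F x0) \<in> minkowski_diff (edom g) K"
      using rel_interior_subset by blast+
    \<comment> \<open>The qualification condition supplies a point of the \<open>K\<close>-epigraph
      over the domain of \<open>g\<close>, which makes the composition proper.\<close>
    then obtain y k where y: "y \<in> edom g" "k \<in> K" "x0 \<in> dom F" "the (F x0) + k = y"
      by (auto simp: minkowski_diff_def)
    then have "(x0, y) \<in> cone_epi K F" using cone_epiI[OF y(3,2)] by simp
    then have comp: "ext_compose g F \<in> Gamma_fun"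
      using Gamma_fun_ext_compose[OF K0 F(2) g gF'] y(1) by blast
    then have proper: "proper_fun ?h" by (rule proper_fun_fenchel_conjugate)
    \<comment> \<open>At the value +\<infinity> weak duality lets \<open>v = 0\<close> attain; at a
      real value the multiplier does; -\<infinity> is excluded by properness.\<close>
    have att: "\<exists>v \<in> ?N. ?h p = ?s v p" for p
    proof (cases "?h p")
      case PInf
      then show ?thesis using le[of p 0] N0 by (intro bexI[of _ 0]) auto
    next
      case (real c)
      then obtain v where "v \<in> ?N" "?s v p \<le> ?h p"
        using conjugate_compose_multiplier[OF K(1-3) F(2) g gF' x0, of p c] by auto
      then show ?thesis using le[of p v] by (intro bexI[of _ v]) auto
    qed (use proper in \<open>auto simp: proper_fun_def\<close>)
    have eq: "eta K g F p = ?h p" for p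
    proof (rule antisym)
      obtain v where "v \<in> ?N" "?h p = ?s v p" using att by blast
      then show "eta K g F p \<le> ?h p" unfolding eta_def by (auto intro: INF_lower)
    qed (rule conjugate_compose_le_eta[OF ge F(1)])
    have "closed_fun (eta K g F)" "convex_fun (eta K g F)" "proper_fun (eta K g F)"
      using proper closed_fun_fenchel_conjugate[of "ext_compose g F"]
        convex_fun_fenchel_conjugate[of "ext_compose g F"]
      unfolding ext[of "eta K g F", OF eq] by simp_all
    then show "closed_fun (eta K g F) \<and> proper_fun (eta K g F) \<and> convex_fun (eta K g F)
        \<and> (\<forall>p. \<exists>v \<in> ?N. eta K g F p = ?s v p)"
      using att eq by simp
    show "\<forall>p. \<exists>v \<in> ?N. ?h p = ?s v p \<and> (\<forall>w \<in> ?N. ?s v p \<le> ?s w p)"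
    proof
      fix p
      obtain v where "v \<in> ?N" "?h p = ?s v p" using att by blast
      then show "\<exists>v \<in> ?N. ?h p = ?s v p \<and> (\<forall>w \<in> ?N. ?s v p \<le> ?s w p)"
        using le[of p] by (intro bexI[of _ v]) auto
    qed
    \<comment> \<open>In \<open>ereal\<close> a sum with one summand +\<infinity> is +\<infinity>,
      whatever the other summand is.\<close>
    have fin: "?s v p < \<infinity> \<longleftrightarrow> v \<in> edom (fenchel_conjugate g) \<and> fenchel_conjugate (scalarize v F) p < \<infinity>"
      for v p
      by (auto simp: edom_def)
    show "edom ?h = {p. \<exists>v \<in> edom (fenchel_conjugate g) \<inter> ?N. fenchel_conjugate (scalarize v F) p < \<infinity>}"
    proof (intro set_eqI iffI)
      fix p assume "p \<in> edom ?h"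
      moreover obtain v where "v \<in> ?N" "?h p = ?s v p" using att by blast
      ultimately show "p \<in> {p. \<exists>v \<in> edom (fenchel_conjugate g) \<inter> ?N. fenchel_conjugate (scalarize v F) p < \<infinity>}"
        using fin[of v p] by (auto simp: edom_def)
    next
      fix p assume "p \<in> {p. \<exists>v \<in> edom (fenchel_conjugate g) \<inter> ?N. fenchel_conjugate (scalarize v F) p < \<infinity>}"
      then obtain v where "?s v p < \<infinity>" using fin by blast
      then show "p \<in> edom ?h" using le_less_trans[OF le] by (simp only: edom_def mem_Collect_eq)
    qed
  qed
  show ?thesis
    by (rule conjI[OF a1 conjI[OF impI impI]], elim conjE, erule (3) a2)
      (intro conjI[OF bc(1) conjI[OF bc(2,3)]])
qed

end
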